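(* Fix an integer $n\ge2$ and let $\{\mathcal T_m\}_{m\ge0}$ be any infinite sequence of partitions obtained by applying the conforming LE $n$-section algorithm to a finite conforming tetrahedral partition $\mathcal T_0$ of a bounded polyhedral domain in $\mathbb R^3$. Then $$h(\mathcal T_m)\longrightarrow0\qquad(m\to\infty),$$ independently of which globally longest edge is selected at each step.
   Context: A tetrahedron is the convex hull of four affinely independent points of $\mathbb R^3$; $h_T=\operatorname{diam}T$ is the length of its longest edge. A tetrahedral partition of a bounded polyhedral domain $\Omega\subset\mathbb R^3$ is a finite collection of tetrahedra with pairwise disjoint interiors and union $\overline\Omega$; it is conforming if the intersection of any two distinct elements is empty or a complete common vertex, edge, or triangular face; $h(\mathcal T)=\max_{T\in\mathcal T}h_T$. Edge $n$-section: for $T=\operatorname{conv}\{A,B,C,D\}$ and its edge $e=AB$, put $P_j=(1-j/n)A+(j/n)B$ ($0\le j\le n$) and $\mathcal N_n(T,e)=\{\operatorname{conv}\{P_{j-1},P_j,C,D\}:1\le j\le n\}$. Conforming LE $n$-section algorithm: start from a finite conforming tetrahedral partition $\mathcal T_0$. Given $\mathcal T_m$, choose any edge $e_m$ of the mesh $\mathcal T_m$ whose length is maximal among all edges of all elements of $\mathcal T_m$ (so $|e_m|=h(\mathcal T_m)$), let $\omega_m(e_m)=\{T\in\mathcal T_m: e_m\text{ is an edge of }T\}$, and set $$\mathcal T_{m+1}=\bigl(\mathcal T_m\setminus\omega_m(e_m)\bigr)\cup\bigcup_{T\in\omega_m(e_m)}\mathcal N_n(T,e_m).$$ One step $m\mapsto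 m+1$ is one such patch operation; the procedure is iterated infinitely many times. *)

theory Defs
  imports "HOL-Analysis.Analysis"
begin

abbreviation tetrahedron :: "(real^3) set \<Rightarrow> bool"
  where "tetrahedron T \<equiv> 3 simplex T"

text \<open>Polyhedrality is read as: the boundary lies in finitely many planes.\<close>

definition polyhedral_domain :: "(real^3) set \<Rightarrow> bool"
  where "polyhedral_domain \<Omega> \<longleftrightarrow>
    open \<Omega> \<and> connected \<Omega> \<and> \<Omega> \<noteq> {} \<and>
    (\<exists>H. finite H \<and> (\<forall>P\<in>H. \<exists>a b. a \<noteq> 0 \<and> P = {x. a \<bullet> x = b}) \<and> frontier \<Omega> \<subseteq> \<Union>H)"

definition tetrahedral_partition :: "(real^3) set set \<Rightarrow> (real^3) set \<Rightarrow> bool"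
  where "tetrahedral_partition M \<Omega> \<longleftrightarrow>
    finite M \<and> (\<forall>T\<in>M. tetrahedron T) \<and>
    pairwise (\<lambda>S T. interior S \<inter> interior T = {}) M \<and>
    \<Union>M = closure \<Omega>"

definition conforming :: "(real^3) set set \<Rightarrow> bool"
  where "conforming M \<longleftrightarrow>
    pairwise (\<lambda>S T. S \<inter> T = {} \<or>
      (\<exists>v. S \<inter> T = {v} \<and> v extreme_point_of S \<and> v extreme_point_of T) \<or>
      (S \<inter> T) edge_of S \<and> (S \<inter> T) edge_of T \<or>
      (S \<inter> T) facet_of S \<and> (S \<inter> T) facet_of T) M"

definition mesh_size :: "(real^3) set set \<Rightarrow> real"
  where "mesh_size M = Max (diameter ` M)"

definition mesh_edges :: "(real^3) set set \<Rightarrow> (real^3) set set"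
  where "mesh_edges M = {e. \<exists>T\<in>M. e edge_of T}"

definition section_point :: "nat \<Rightarrow> real^3 \<Rightarrow> real^3 \<Rightarrow> nat \<Rightarrow> real^3"
  where "section_point n A B j = (1 - real j / real n) *\<^sub>R A + (real j / real n) *\<^sub>R B"

text \<open>The vertices of a tetrahedron are determined by it up to order, and exchanging
  \<open>A\<close> with \<open>B\<close> or \<open>C\<close> with \<open>D\<close> does not change the collection of pieces. Hence all
  labellings admitted by the existential quantifier below describe one and the same
  collection of \<open>n\<close> tetrahedra.\<close>

definition edge_section :: "nat \<Rightarrow> (real^3) set \<Rightarrow> (real^3) set \<Rightarrow> (real^3) set set"
  where "edge_section n T e = {S. \<exists>A B C D j.
    card {A, B, C, D} = 4 \<and> \<not> affine_dependent {A, B, C, D} \<and>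
    T = convex hull {A, B, C, D} \<and> e = closed_segment A B \<and>
    j \<in> {1..n} \<and>
    S = convex hull {section_point n A B (j - 1), section_point n A B j, C, D}}"

definition edge_patch :: "(real^3) set set \<Rightarrow> (real^3) set \<Rightarrow> (real^3) set set"
  where "edge_patch M e = {T \<in> M. e edge_of T}"

definition le_section_step :: "nat \<Rightarrow> (real^3) set set \<Rightarrow> (real^3) set set \<Rightarrow> bool"
  where "le_section_step n M M' \<longleftrightarrow>
    (\<exists>e \<in> mesh_edges M.
      (\<forall>e' \<in> mesh_edges M. diameter e' \<le> diameter e) \<and>
      M' = (M - edge_patch M e) \<union> (\<Union>T \<in> edge_patch M e. edge_section n T e))"

end

theory Submission
  imports Defs
begin

text \<open>
  Let \<open>e = AB\<close> be a longest edge of the mesh and let \<open>P\<close> divide it in the ratio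
  \<open>t : 1 - t\<close>. For every vertex \<open>C\<close> of a tetrahedron containing \<open>e\<close>, the edges \<open>AC\<close> and
  \<open>BC\<close> are at most as long as \<open>AB\<close>, so Stewart's identity gives
  \<open>|PC|\<^sup>2 = (1 - t) |AC|\<^sup>2 + t |BC|\<^sup>2 - t (1 - t) |AB|\<^sup>2 \<le> (1 - t (1 - t)) |AB|\<^sup>2\<close>.
  If \<open>P\<close> is an interior section point, then \<open>t (1 - t) \<ge> 1 / n\<^sup>2\<close>. Hence every edge created by
  a step is at most \<open>c |e|\<close> long, where \<open>c < 1\<close> depends only on \<open>n\<close> (\<open>edge_of_piece\<close>).

  Each step also destroys \<open>e\<close>, because all tetrahedra that contain \<open>e\<close> are divided. Suppose
  that all edges have length at most \<open>a\<close>. As long as some edge is longer than \<open>c a\<close>, a step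
  destroys one such edge and creates none; since a mesh has finitely many edges, all lengths are
  at most \<open>c a\<close> after finitely many steps (\<open>weight_bound_contracts\<close>). Iterating
  this, the maximal edge length, which is the mesh size, tends to zero, whichever longest edges
  are chosen.
\<close>

section \<open>Repeatedly removing a heaviest element\<close>

text \<open>The weights below will be the lengths of the edges in a sequence of meshes.\<close>

context
  fixes E :: "nat \<Rightarrow> 'a set" and w :: "'a \<Rightarrow> real" and c :: real
  assumes finite_E: "\<And>m. finite (E m)"
    and c: "0 \<le> c" "c < 1"
    and nonneg: "\<And>m f. f \<in> E m \<Longrightarrow> 0 \<le> w f"
    and step: "\<And>m. \<exists>e\<in>E m. (\<forall>f\<in>E m. w f \<le> w e) \<and>
      E (Suc m) \<subseteq> (E m - {e}) \<union> {f. w f \<le> c * w e}"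
begin

lemma weight_bound_Suc:
  assumes "\<forall>f\<in>E m. w f \<le> a"
  shows "\<forall>f\<in>E (Suc m). w f \<le> a"
proof -
  obtain e where e: "e \<in> E m" "E (Suc m) \<subseteq> (E m - {e}) \<union> {f. w f \<le> c * w e}"
    using step by meson
  have "c * w e \<le> w e"
    using mult_right_mono[of c 1 "w e"] c nonneg[OF e(1)] by simp
  then have "c * w e \<le> a" using assms e(1) by fastforce
  then show ?thesis using e(2) assms by fastforce
qed

lemma weight_bound_later:
  assumes "\<forall>f\<in>E m. w f \<le> a" "m \<le> k"
  shows "\<forall>f\<in>E k. w f \<le> a"
  using assms(2)
  by (induction k rule: dec_induct) (use assms(1) weight_bound_Suc in auto)

text \<open>As long as some weight exceeds \<open>c * a\<close>, each step removes such an element, namely a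
  heaviest one, and adds none; so the number of such elements drops until it is zero.\<close>

lemma weight_bound_contracts:
  assumes "\<forall>f\<in>E m. w f \<le> a"
  shows "\<exists>k. \<forall>f\<in>E k. w f \<le> c * a"
  using assms
proof (induction "card {f\<in>E m. w f > c * a}" arbitrary: m rule: less_induct)
  case less
  show ?case
  proof (cases "\<forall>f\<in>E m. w f \<le> c * a")
    case False
    obtain e where e: "e \<in> E m" "\<forall>f\<in>E m. w f \<le> w e"
      "E (Suc m) \<subseteq> (E m - {e}) \<union> {f. w f \<le> c * w e}"
      using step by meson
    have "c * w e \<le> c * a" using c e(1) less.prems by (simp add: mult_left_mono)
    then have "{f\<in>E (Suc m). w f > c * a} \<subseteq> {f\<in>E m. w f > c * a} - {e}"
      using e(3) by fastforce
    moreover have "e \<in> {f\<in>E m. w f > c * a}" using False e(1,2) by fastforce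
    ultimately have "{f\<in>E (Suc m). w f > c * a} \<subset> {f\<in>E m. w f > c * a}" by blast
    then have "card {f\<in>E (Suc m). w f > c * a} < card {f\<in>E m. w f > c * a}"
      by (rule psubset_card_mono[rotated]) (simp add: finite_E)
    then show ?thesis using less.hyps weight_bound_Suc[OF less.prems] by blast
  qed blast
qed

lemma weights_eventually_small:
  assumes "\<epsilon> > 0"
  shows "\<forall>\<^sub>F m in sequentially. \<forall>f\<in>E m. w f < \<epsilon>"
proof -
  obtain e where e: "\<forall>f\<in>E 0. w f \<le> w e"
    using step by meson
  have geometric: "\<exists>m. \<forall>f\<in>E m. w f \<le> c ^ k * w e" for k
  proof (induction k)
    case 0
    then show ?case using e by (intro exI[of _ 0]) simp
  next
    case (Suc k)
    then obtain m where "\<forall>f\<in>E m. w f \<le> c ^ k * w e" ..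
    from weight_bound_contracts[OF this] show ?case by (simp add: mult.assoc)
  qed
  have "(\<lambda>k. c ^ k * w e) \<longlonglongrightarrow> 0"
    using c by (intro tendsto_mult_left_zero LIMSEQ_realpow_zero)
  then have "\<forall>\<^sub>F k in sequentially. c ^ k * w e < \<epsilon>"
    using assms by (rule order_tendstoD(2))
  then obtain k where k: "c ^ k * w e < \<epsilon>"
    using eventually_happens'[OF sequentially_bot] by blast
  obtain m where "\<forall>f\<in>E m. w f \<le> c ^ k * w e" using geometric by blast
  then have "\<forall>f\<in>E i. w f < \<epsilon>" if "i \<ge> m" for i
    using weight_bound_later[OF _ that] k by fastforce
  then show ?thesis unfolding eventually_sequentially by blast
qed

end

section \<open>Edges and diameter of a simplex\<close>

lemma edge_of_simplex_iff:
  fixes V :: "'a::euclidean_space set"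
  assumes "\<not> affine_dependent V"
  shows "f edge_of convex hull V \<longleftrightarrow> (\<exists>x\<in>V. \<exists>y\<in>V. x \<noteq> y \<and> f = closed_segment x y)"
proof
  assume f: "f edge_of convex hull V"
  then obtain W where W: "W \<subseteq> V" "f = convex hull W"
    unfolding edge_of_def face_of_convex_hull_affine_independent[OF assms] by blast
  have "\<not> affine_dependent W" using W(1) assms affine_dependent_subset by blast
  then have "int (card W) = aff_dim W + 1" by (rule aff_dim_affine_independent)
  moreover have "aff_dim W = 1"
    using f unfolding edge_of_def W(2) aff_dim_convex_hull by blast
  ultimately have "card W = 2" by simp
  then obtain x y where "W = {x, y}" "x \<noteq> y" unfolding card_2_iff by blast
  then show "\<exists>x\<in>V. \<exists>y\<in>V. x \<noteq> y \<and> f = closed_segment x y"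
    using W by (intro bexI[of _ x] bexI[of _ y]) (simp_all add: segment_convex_hull)
next
  assume "\<exists>x\<in>V. \<exists>y\<in>V. x \<noteq> y \<and> f = closed_segment x y"
  then obtain x y where xy: "x \<in> V" "y \<in> V" "x \<noteq> y" "f = convex hull {x, y}"
    unfolding segment_convex_hull by blast
  moreover have "f face_of convex hull V"
    unfolding face_of_convex_hull_affine_independent[OF assms]
    by (rule exI[of _ "{x, y}"]) (use xy(1,2,4) in simp)
  moreover have "aff_dim f = 1"
    unfolding xy(4) aff_dim_convex_hull aff_dim_2 using xy(3) by simp
  ultimately show "f edge_of convex hull V" unfolding edge_of_def by blast
qed

lemma diameter_closed_segment:
  fixes a b :: "'a::euclidean_space"
  shows "diameter (closed_segment a b) = dist a b"
proof (rule antisym)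
  have bound: "norm (x - y) \<le> dist a b"
    if "x \<in> convex hull {a, b}" "y \<in> convex hull {a, b}" for x y
  proof -
    obtain u v where uv: "u \<in> {a, b}" "v \<in> {a, b}"
      "\<forall>x\<in>convex hull {a, b}. \<forall>y\<in>convex hull {a, b}. norm (x - y) \<le> norm (u - v)"
      using simplex_extremal_le[of "{a, b}"] by blast
    have "norm (x - y) \<le> dist u v" using uv(3) that unfolding dist_norm by blast
    also have "\<dots> \<le> dist a b" using uv(1,2) by (auto simp: dist_commute)
    finally show ?thesis .
  qed
  show "diameter (closed_segment a b) \<le> dist a b"
    unfolding segment_convex_hull by (rule diameter_le) (use bound in simp_all)
  show "dist a b \<le> diameter (closed_segment a b)"
    by (rule diameter_bounded_bound) (simp_all add: bounded_closed_segment)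
qed

text \<open>The distance on a simplex is maximal between two vertices, and any two vertices of a simplex
  span an edge.\<close>

lemma diameter_tetrahedron_attained:
  assumes "tetrahedron T"
  obtains f where "f edge_of T" "diameter T \<le> diameter f"
proof -
  obtain V where V: "\<not> affine_dependent V" "card V = 4" "T = convex hull V"
    using assms by (auto simp: simplex_def)
  then have "finite V" "V \<noteq> {}" by (auto intro: card_ge_0_finite)
  then obtain u v where uv: "u \<in> V" "v \<in> V"
    "\<And>x y. x \<in> T \<Longrightarrow> y \<in> T \<Longrightarrow> norm (x - y) \<le> norm (u - v)"
    using simplex_extremal_le V(3) by metis
  have "u \<noteq> v"
  proof
    assume "u = v"
    then have "x = u" if "x \<in> V" for x
      using uv that V(3) hull_inc[of _ V convex] by fastforce
    then have "V \<subseteq> {u}" by blast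
    then show False using V(2) card_mono[of "{u}" V] by simp
  qed
  show ?thesis
  proof
    show "closed_segment u v edge_of T"
      using uv \<open>u \<noteq> v\<close> V edge_of_simplex_iff by blast
    show "diameter T \<le> diameter (closed_segment u v)"
      using uv(3) by (intro diameter_le) (auto simp: diameter_closed_segment dist_norm)
  qed
qed

section \<open>One step of the algorithm\<close>

lemma section_point_eq: "section_point n A B j = A + (real j / real n) *\<^sub>R (B - A)"
  by (simp add: section_point_def scaleR_left_diff_distrib scaleR_right_diff_distrib)

lemma section_point_endpoints:
  assumes "n > 0"
  shows "section_point n A B 0 = A" "section_point n A B n = B"
  using assms by (auto simp: section_point_def)

lemma dist_section_points:
  assumes "j \<in> {1..n}"
  shows "dist (section_point n A B (j - 1)) (section_point n A B j) = dist A B / n"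
proof -
  have "section_point n A B (j - 1) - section_point n A B j =
      (real (j - 1) / real n - real j / real n) *\<^sub>R (B - A)"
    unfolding section_point_eq scaleR_left_diff_distrib by simp
  also have "real (j - 1) / real n - real j / real n = - (1 / n)"
    using assms by (simp add: of_nat_diff diff_divide_distrib)
  finally show ?thesis by (simp add: dist_norm norm_minus_commute)
qed

lemma stewart:
  fixes A B C :: "'a::real_inner"
  shows "(dist ((1 - t) *\<^sub>R A + t *\<^sub>R B) C)\<^sup>2 =
    (1 - t) * (dist A C)\<^sup>2 + t * (dist B C)\<^sup>2 - t * (1 - t) * (dist A B)\<^sup>2"
  unfolding dist_norm power2_norm_eq_inner
  by (simp add: inner_commute algebra_simps)

text \<open>At the interior section points, the product \<open>t (1 - t) = j (n - j) / n\<^sup>2\<close> in Stewart's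
  identity is at least \<open>1 / n\<^sup>2\<close>. This bound is not sharp for \<open>n > 2\<close>,
  but any factor below 1 serves.\<close>

definition contraction :: "nat \<Rightarrow> real"
  where "contraction n = sqrt (1 - 1 / (real n)\<^sup>2)"

lemma dist_section_point_apex:
  assumes "0 < j" "j < n" "dist A C \<le> dist A B" "dist B C \<le> dist A B"
  shows "dist (section_point n A B j) C \<le> contraction n * dist A B"
proof -
  define t where "t = real j / real n"
  have t: "0 \<le> t" "t \<le> 1" using assms by (auto simp: t_def)
  have "1 * 1 \<le> real j * real (n - j)" using assms by (intro mult_mono) auto
  then have tt: "1 / (real n)\<^sup>2 \<le> t * (1 - t)"
    using assms by (simp add: t_def field_simps power2_eq_square of_nat_diff)
  have "(dist (section_point n A B j) C)\<^sup>2 =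
      (1 - t) * (dist A C)\<^sup>2 + t * (dist B C)\<^sup>2 - t * (1 - t) * (dist A B)\<^sup>2"
    unfolding section_point_def t_def[symmetric] by (rule stewart)
  also have "\<dots> \<le> (1 - t) * (dist A B)\<^sup>2 + t * (dist A B)\<^sup>2 - 1 / (real n)\<^sup>2 * (dist A B)\<^sup>2"
    using t tt assms by (intro diff_mono add_mono mult_left_mono mult_right_mono power_mono) auto
  also have "\<dots> = (1 - 1 / (real n)\<^sup>2) * (dist A B)\<^sup>2" by (simp add: algebra_simps)
  finally have "dist (section_point n A B j) C \<le> sqrt ((1 - 1 / (real n)\<^sup>2) * (dist A B)\<^sup>2)"
    by (rule real_le_rsqrt)
  then show ?thesis by (simp add: contraction_def real_sqrt_mult)
qed

lemma inverse_le_contraction: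
  assumes "n \<ge> 2"
  shows "1 / real n \<le> contraction n"
proof -
  have "2 * 2 \<le> (real n)\<^sup>2" unfolding power2_eq_square using assms by (intro mult_mono) auto
  then show ?thesis
    unfolding contraction_def
    by (intro real_le_rsqrt) (use assms in \<open>simp add: power_divide le_diff_eq divide_le_eq\<close>)
qed

lemma contraction_bounds:
  assumes "n \<ge> 2"
  shows "0 \<le> contraction n" "contraction n < 1"
proof -
  show "0 \<le> contraction n"
    using inverse_le_contraction[OF assms] by (rule order_trans[rotated]) simp
  show "contraction n < 1" using assms by (simp add: contraction_def)
qed

text \<open>The two section points span the same line as \<open>A\<close> and \<open>B\<close>. So the four vertices of a piece
  have the same three-dimensional affine hull as those of the divided tetrahedron, and four points
  can only span it if they are affinely independent.\<close>

lemma section_tetrahedron_independent: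
  assumes indep: "\<not> affine_dependent {A, B, C, D}" "card {A, B, C, D} = 4" and j: "j \<in> {1..n}"
  shows "\<not> affine_dependent {section_point n A B (j - 1), section_point n A B j, C, D}"
    and "card {section_point n A B (j - 1), section_point n A B j, C, D} = 4"
proof -
  define P Q where "P = section_point n A B (j - 1)" and "Q = section_point n A B j"
  let ?V = "{P, Q, C, D}"
  have line: "A + ((real (j - 1) + r) / real n) *\<^sub>R (B - A) \<in> affine hull ?V" for r
  proof -
    have "A + ((real (j - 1) + r) / real n) *\<^sub>R (B - A) = P + r *\<^sub>R ((1 / real n) *\<^sub>R (B - A))"
      by (simp add: P_def section_point_eq add_divide_distrib scaleR_left_distrib)
    also have "(1 / real n) *\<^sub>R (B - A) = (real j / real n - real (j - 1) / real n) *\<^sub>R (B - A)"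
      using j by (simp add: of_nat_diff diff_divide_distrib)
    also have "\<dots> = Q - P"
      unfolding P_def Q_def section_point_eq scaleR_left_diff_distrib by simp
    also have "P + r *\<^sub>R (Q - P) = (1 - r) *\<^sub>R P + r *\<^sub>R Q"
      by (simp add: scaleR_left_diff_distrib scaleR_right_diff_distrib)
    also have "\<dots> \<in> affine hull ?V"
      by (rule mem_affine) (auto intro: hull_inc)
    finally show ?thesis .
  qed
  \<comment> \<open>The two values of \<open>r\<close> are the affine coordinates of \<open>A\<close> and \<open>B\<close> in which \<open>P\<close> is 0 and
    \<open>Q\<close> is 1.\<close>
  have "A \<in> affine hull ?V" "B \<in> affine hull ?V"
    using line[of "- real (j - 1)"] line[of "real n - real (j - 1)"] j by auto
  then have "{A, B, C, D} \<subseteq> affine hull ?V" by (auto intro: hull_inc)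
  then have "aff_dim {A, B, C, D} \<le> aff_dim ?V"
    using aff_dim_subset aff_dim_affine_hull by metis
  moreover have "aff_dim {A, B, C, D} = 3"
    using aff_dim_affine_independent[OF indep(1)] unfolding indep(2) by simp
  moreover have "aff_dim ?V \<le> int (card ?V) - 1" by (rule aff_dim_le_card) simp
  moreover have "card ?V \<le> 4" by (simp add: card_insert_if)
  ultimately have "card ?V = 4" "aff_dim ?V = int (card ?V) - 1" by auto
  then show "\<not> affine_dependent {section_point n A B (j - 1), section_point n A B j, C, D}"
    "card {section_point n A B (j - 1), section_point n A B j, C, D} = 4"
    unfolding P_def Q_def by (auto simp: affine_independent_iff_card)
qed

text \<open>The diameter of a polytope need not be attained by an edge, but that of a simplex is. Since
  the pieces stay simplices, bounds on edge lengths remain bounds on the mesh size.\<close>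

lemma edge_section_tetrahedron:
  assumes "S \<in> edge_section n T e"
  shows "tetrahedron S"
proof -
  obtain A B C D j where "card {A, B, C, D} = 4" "\<not> affine_dependent {A, B, C, D}" "j \<in> {1..n}"
    and S: "S = convex hull {section_point n A B (j - 1), section_point n A B j, C, D}"
    using assms unfolding edge_section_def by blast
  then have "\<not> affine_dependent {section_point n A B (j - 1), section_point n A B j, C, D}"
    "card {section_point n A B (j - 1), section_point n A B j, C, D} = 4"
    using section_tetrahedron_independent by blast+
  then show ?thesis
    unfolding simplex_def S
    by (intro exI[of _ "{section_point n A B (j - 1), section_point n A B j, C, D}"]) simp
qed

text \<open>All labellings \<open>A, B, C, D\<close> in the definition of the section use the same finite set of
  vertices, namely the extreme points of the tetrahedron.\<close>

lemma finite_edge_section: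
  assumes "tetrahedron T"
  shows "finite (edge_section n T e)"
proof -
  define V where "V = {x. x extreme_point_of T}"
  obtain W where W: "\<not> affine_dependent W" "T = convex hull W"
    using assms by (auto simp: simplex_def)
  then have "V = W"
    by (simp add: V_def extreme_point_of_convex_hull_affine_independent)
  then have "finite V" using W(1) aff_independent_finite by blast
  let ?piece = "\<lambda>(A, B, C, D, j). convex hull {section_point n A B (j - 1), section_point n A B j, C, D}"
  have "edge_section n T e \<subseteq> ?piece ` (V \<times> V \<times> V \<times> V \<times> {1..n})"
  proof
    fix S assume "S \<in> edge_section n T e"
    then obtain A B C D j where "\<not> affine_dependent {A, B, C, D}"
      "T = convex hull {A, B, C, D}" "j \<in> {1..n}" and S: "S = ?piece (A, B, C, D, j)"
      unfolding edge_section_def by auto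
    then have "(A, B, C, D, j) \<in> V \<times> V \<times> V \<times> V \<times> {1..n}"
      by (simp add: V_def extreme_point_of_convex_hull_affine_independent)
    then show "S \<in> ?piece ` (V \<times> V \<times> V \<times> V \<times> {1..n})" unfolding S by (rule imageI)
  qed
  then show ?thesis by (rule finite_subset) (use \<open>finite V\<close> in simp)
qed

text \<open>An edge of a piece joins two of \<open>P\<close>, \<open>Q\<close>, \<open>C\<close>, \<open>D\<close> for consecutive section points
  \<open>P\<close> and \<open>Q\<close>. It is short by Stewart's identity if it joins an interior section point to \<open>C\<close>
  or \<open>D\<close>, and short as a fraction \<open>1 / n\<close> of \<open>e\<close> if it is \<open>PQ\<close>. Otherwise it is one of the five
  edges other than \<open>e\<close> of the divided tetrahedron, because the first and the last section point
  are \<open>A\<close> and \<open>B\<close>.\<close>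

lemma edge_of_piece:
  assumes n: "n \<ge> 2" and S: "S \<in> edge_section n T e" and f: "f edge_of S"
    and longest: "\<And>g. g edge_of T \<Longrightarrow> diameter g \<le> diameter e"
  shows "f edge_of T \<and> f \<noteq> e \<or> diameter f \<le> contraction n * diameter e"
proof -
  obtain A B C D j where ABCD: "card {A, B, C, D} = 4" "\<not> affine_dependent {A, B, C, D}"
    and T: "T = convex hull {A, B, C, D}" and e: "e = closed_segment A B" and j: "j \<in> {1..n}"
    and S: "S = convex hull {section_point n A B (j - 1), section_point n A B j, C, D}"
    using S unfolding edge_section_def by blast
  let ?good = "\<lambda>f. f edge_of T \<and> f \<noteq> e \<or> diameter f \<le> contraction n * diameter e"
  have distinct: "A \<noteq> B" "A \<noteq> C" "A \<noteq> D" "B \<noteq> C" "B \<noteq> D" "C \<noteq> D"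
    using ABCD(1) by (auto simp: card_insert_if split: if_splits)
  have edge: "closed_segment x y edge_of T"
    if "x \<in> {A, B, C, D}" "y \<in> {A, B, C, D}" "x \<noteq> y" for x y
    unfolding T edge_of_simplex_iff[OF ABCD(2)] using that by blast
  have other: "?good (closed_segment x y)"
    if "x \<in> {A, B, C, D}" "y \<in> {C, D}" "x \<noteq> y" for x y
    using edge[of x y] that distinct by (auto simp: e closed_segment_eq doubleton_eq_iff)
  have apex: "?good (closed_segment (section_point n A B i) X)" if "i \<le> n" "X \<in> {C, D}" for i X
  proof -
    consider "i = 0" | "i = n" | "0 < i" "i < n" using \<open>i \<le> n\<close> by linarith
    then show ?thesis
    proof cases
      case 3
      have "dist A X \<le> dist A B" "dist B X \<le> dist A B"
        using longest[OF edge[of A X]] longest[OF edge[of B X]] that distinct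
        by (auto simp: e diameter_closed_segment)
      then show ?thesis
        using dist_section_point_apex 3 by (simp add: e diameter_closed_segment)
    qed (use other[of A X] other[of B X] that distinct n section_point_endpoints in auto)
  qed
  have base: "?good (closed_segment (section_point n A B (j - 1)) (section_point n A B j))"
    using mult_right_mono[OF inverse_le_contraction[OF n], of "dist A B"]
    unfolding e diameter_closed_segment dist_section_points[OF j] by simp
  obtain x y where xy: "x \<in> {section_point n A B (j - 1), section_point n A B j, C, D}"
    "y \<in> {section_point n A B (j - 1), section_point n A B j, C, D}" "x \<noteq> y"
    "f = closed_segment x y"
    using f edge_of_simplex_iff[OF section_tetrahedron_independent(1)[OF ABCD(2,1) j]]
    unfolding S by blast
  \<comment> \<open>The names hide the segments and section points, so that the cases can be
    settled by logic alone.\<close>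
  define G where "G u v \<longleftrightarrow> ?good (closed_segment u v)" for u v
  define P Q where "P = section_point n A B (j - 1)" and "Q = section_point n A B j"
  have "j - 1 \<le> n" "j \<le> n" using j by auto
  then have "G P X" "G Q X" if "X \<in> {C, D}" for X
    using apex that unfolding G_def P_def Q_def by blast+
  moreover have "G P Q" using base unfolding G_def P_def Q_def .
  moreover have "G C D" using other[of C D] distinct unfolding G_def by blast
  moreover have "G v u \<longleftrightarrow> G u v" for u v unfolding G_def by (simp only: closed_segment_commute)
  ultimately have "G x y" using xy(1-3) unfolding P_def[symmetric] Q_def[symmetric] by blast
  then show ?thesis unfolding G_def xy(4) .
qed

text \<open>The edge \<open>e\<close> disappears because no tetrahedron outside its patch contains it and no piece
  of a tetrahedron in the patch has it as an edge.\<close>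

lemma mesh_edges_step:
  assumes n: "n \<ge> 2" and step: "le_section_step n M M'"
  shows "\<exists>e\<in>mesh_edges M. (\<forall>f\<in>mesh_edges M. diameter f \<le> diameter e) \<and>
    mesh_edges M' \<subseteq> (mesh_edges M - {e}) \<union> {f. diameter f \<le> contraction n * diameter e}"
proof -
  obtain e where e: "e \<in> mesh_edges M" "\<forall>f\<in>mesh_edges M. diameter f \<le> diameter e"
    and M': "M' = (M - edge_patch M e) \<union> (\<Union>T \<in> edge_patch M e. edge_section n T e)"
    using step unfolding le_section_step_def by blast
  have "f \<in> (mesh_edges M - {e}) \<union> {f. diameter f \<le> contraction n * diameter e}"
    if f: "f \<in> mesh_edges M'" for f
  proof -
    obtain S where S: "S \<in> M'" "f edge_of S" using f by (auto simp: mesh_edges_def)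
    show ?thesis
    proof (cases "S \<in> M - edge_patch M e")
      case True
      then show ?thesis using S(2) by (auto simp: mesh_edges_def edge_patch_def)
    next
      case False
      then obtain T where T: "T \<in> M" "S \<in> edge_section n T e"
        using S(1) M' by (auto simp: edge_patch_def)
      then show ?thesis
        using edge_of_piece[OF n T(2) S(2)] e(2) by (auto simp: mesh_edges_def)
    qed
  qed
  then show ?thesis using e by blast
qed

lemma le_section_step_preserves:
  assumes "le_section_step n M M'" "finite M" "\<forall>T\<in>M. tetrahedron T"
  shows "finite M'" "\<forall>T\<in>M'. tetrahedron T"
  using assms finite_edge_section edge_section_tetrahedron
  by (auto simp: le_section_step_def edge_patch_def)

theorem proposition3:
  fixes n :: nat and \<Omega> :: "(real^3) set" and \<T> :: "nat \<Rightarrow> (real^3) set set"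
  assumes "n \<ge> 2"
    and "polyhedral_domain \<Omega>" and "bounded \<Omega>"
    and "tetrahedral_partition (\<T> 0) \<Omega>" and "conforming (\<T> 0)"
    and "\<And>m. le_section_step n (\<T> m) (\<T> (Suc m))"
  shows "(\<lambda>m. mesh_size (\<T> m)) \<longlonglongrightarrow> 0"
proof -
  have mesh: "finite (\<T> m) \<and> (\<forall>T\<in>\<T> m. tetrahedron T)" for m
  proof (induction m)
    case 0
    show ?case using assms(4) by (simp add: tetrahedral_partition_def)
  next
    case (Suc m)
    then show ?case using le_section_step_preserves[OF assms(6)] by blast
  qed
  have polytope: "polytope T" if "T \<in> \<T> m" for m T
    using mesh that simplex_imp_polytope by blast
  then have compact: "compact T" if "T \<in> \<T> m" for m T
    using that polytope_imp_compact by blast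
  have "finite {f. f edge_of T}" if "T \<in> \<T> m" for m T
    by (rule finite_subset[OF _ finite_polytope_faces[OF polytope[OF that]]])
      (auto simp: edge_of_def)
  then have "finite (\<Union>T\<in>\<T> m. {f. f edge_of T})" for m
    using mesh by blast
  moreover have "mesh_edges (\<T> m) = (\<Union>T\<in>\<T> m. {f. f edge_of T})" for m
    by (auto simp: mesh_edges_def)
  ultimately have finite_edges: "finite (mesh_edges (\<T> m))" for m by simp
  have nonempty: "\<T> m \<noteq> {}" for m
    using assms(6)[of m] by (auto simp: le_section_step_def mesh_edges_def)
  have edge_nonneg: "0 \<le> diameter f" if f: "f \<in> mesh_edges (\<T> m)" for m f
  proof -
    obtain T where "T \<in> \<T> m" "f face_of T"
      using f unfolding mesh_edges_def edge_of_def by blast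
    then have "bounded f"
      using compact compact_imp_bounded face_of_imp_subset bounded_subset by metis
    then show ?thesis by (rule diameter_ge_0)
  qed
  have small_edges: "\<forall>\<^sub>F m in sequentially. \<forall>f\<in>mesh_edges (\<T> m). diameter f < \<epsilon>"
    if "0 < \<epsilon>" for \<epsilon>
    by (rule weights_eventually_small[where E = "\<lambda>m. mesh_edges (\<T> m)" and w = diameter])
      (use finite_edges contraction_bounds[OF assms(1)] edge_nonneg
        mesh_edges_step[OF assms(1,6)] that in blast)+
  show ?thesis
  proof (rule order_tendstoI)
    fix a :: real assume "a < 0"
    moreover have "0 \<le> mesh_size (\<T> m)" for m
    proof -
      obtain T where T: "T \<in> \<T> m" using nonempty by blast
      have "0 \<le> diameter T" using compact[OF T] by (simp add: compact_imp_bounded diameter_ge_0)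
      also have "\<dots> \<le> mesh_size (\<T> m)"
        unfolding mesh_size_def using T mesh by (intro Max_ge) auto
      finally show ?thesis .
    qed
    ultimately show "\<forall>\<^sub>F m in sequentially. a < mesh_size (\<T> m)"
      by (intro always_eventually) (meson less_le_trans)
  next
    fix \<epsilon> :: real assume "0 < \<epsilon>"
    from small_edges[OF this] show "\<forall>\<^sub>F m in sequentially. mesh_size (\<T> m) < \<epsilon>"
    proof (rule eventually_mono)
      fix m assume small: "\<forall>f\<in>mesh_edges (\<T> m). diameter f < \<epsilon>"
      have "diameter T < \<epsilon>" if T: "T \<in> \<T> m" for T
      proof -
        obtain f where "f edge_of T" "diameter T \<le> diameter f"
          using diameter_tetrahedron_attained mesh T by blast
        moreover have "f \<in> mesh_edges (\<T> m)"
          using \<open>f edge_of T\<close> T by (auto simp: mesh_edges_def)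
        ultimately show ?thesis using small by fastforce
      qed
      then show "mesh_size (\<T> m) < \<epsilon>"
        unfolding mesh_size_def using mesh nonempty by simp
    qed
  qed
qed

end
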